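(* Let $n\ge 2$, let $(\mathfrak{L},\cdot)$ be a commutative associative algebra over $\mathbb{C}$, and let $(\mathfrak{L},[\cdot,\ldots,\cdot])$ be an $n$-Lie algebra on the same vector space. Then $(\mathfrak{L},\cdot,[\cdot,\ldots,\cdot])$ is both a Poisson $n$-Lie algebra and a transposed Poisson $n$-Lie algebra if and only if $$x\cdot[y_1,\ldots,y_n]=[x\cdot y_1,y_2,\ldots,y_n]=0\quad\text{for all } x,y_1,\ldots,y_n\in\mathfrak{L}.$$
   Context: An $n$-Lie algebra is a vector space $\mathfrak{L}$ with an anticommutative (i.e. alternating) $n$-linear operation $[\cdot,\ldots,\cdot]$ satisfying $$[[x_1,\ldots,x_n],y_2,\ldots,y_n]=\sum_{i=1}^n [x_1,\ldots,[x_i,y_2,\ldots,y_n],\ldots,x_n].$$ Let $(\mathfrak{L},\cdot)$ be a commutative associative algebra (not necessarily unital) and $(\mathfrak{L},[\cdot,\ldots,\cdot])$ an $n$-Lie algebra. The triple $(\mathfrak{L},\cdot,[\cdot,\ldots,\cdot])$ is a Poisson $n$-Lie algebra if $$[x\cdot y,z_2,\ldots,z_n]=x\cdot[y,z_2,\ldots,z_n]+[x,z_2,\ldots,z_n]\cdot y$$ for all elements, and a transposed Poisson $n$-Lie algebra if $$z\cdot[x_1,\ldots,x_n]=\frac1n\sum_{i=1}^n[x_1,\ldots,z\cdot x_i,\ldots,x_n]$$ for all elements. *)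

theory Defs
  imports Complex_Main
begin

text \<open>
  The underlying vector space is a whole type, with an explicit scalar multiplication. The
  multiplication need not be unital.
\<close>

locale comm_assoc_algebra = vector_space scale
  for scale :: "'k::field \<Rightarrow> 'a::ab_group_add \<Rightarrow> 'a" +
  fixes mult :: "'a \<Rightarrow> 'a \<Rightarrow> 'a"  (infixl \<open>\<cdot>\<close> 70)
  assumes mult_linear_left: "Vector_Spaces.linear scale scale (\<lambda>x. x \<cdot> y)"
    and mult_linear_right: "Vector_Spaces.linear scale scale (\<lambda>y. x \<cdot> y)"
    and mult_commute: "x \<cdot> y = y \<cdot> x"
    and mult_assoc: "(x \<cdot> y) \<cdot> z = x \<cdot> (y \<cdot> z)"

text \<open>
  An \<open>n\<close>-ary bracket is a function on lists; only its values on lists of length \<open>n\<close> are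
  constrained or used. Indices start at 0, so \<open>xs[i := u]\<close> is the argument list
  \<open>x\<^sub>1, \<dots>, u, \<dots>, x\<^sub>n\<close> with \<open>u\<close> in position \<open>i + 1\<close>, and \<open>ys\<close> of length \<open>n - 1\<close> stands
  for \<open>y\<^sub>2, \<dots>, y\<^sub>n\<close>.
\<close>

locale n_lie_algebra = vector_space scale
  for scale :: "'k::field \<Rightarrow> 'a::ab_group_add \<Rightarrow> 'a" +
  fixes n :: nat
    and br :: "'a list \<Rightarrow> 'a"
  assumes br_multilinear:
      "\<lbrakk>length xs = n; i < n\<rbrakk> \<Longrightarrow> Vector_Spaces.linear scale scale (\<lambda>u. br (xs[i := u]))"
    and br_alternating:
      "\<lbrakk>length xs = n; i < n; j < n; i \<noteq> j; xs ! i = xs ! j\<rbrakk> \<Longrightarrow> br xs = 0"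
    and br_fundamental_identity:
      "\<lbrakk>length xs = n; length ys = n - 1\<rbrakk> \<Longrightarrow>
        br (br xs # ys) = (\<Sum>i<n. br (xs[i := br (xs ! i # ys)]))"

locale poisson_n_lie_algebra =
  comm_assoc_algebra scale mult + n_lie_algebra scale n br
  for scale :: "'k::field \<Rightarrow> 'a::ab_group_add \<Rightarrow> 'a"
    and mult :: "'a \<Rightarrow> 'a \<Rightarrow> 'a"  (infixl \<open>\<cdot>\<close> 70)
    and n :: nat
    and br :: "'a list \<Rightarrow> 'a" +
  assumes leibniz:
    "length zs = n - 1 \<Longrightarrow> br ((x \<cdot> y) # zs) = x \<cdot> br (y # zs) + br (x # zs) \<cdot> y"

locale transposed_poisson_n_lie_algebra =
  comm_assoc_algebra scale mult + n_lie_algebra scale n br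
  for scale :: "'k::field \<Rightarrow> 'a::ab_group_add \<Rightarrow> 'a"
    and mult :: "'a \<Rightarrow> 'a \<Rightarrow> 'a"  (infixl \<open>\<cdot>\<close> 70)
    and n :: nat
    and br :: "'a list \<Rightarrow> 'a" +
  assumes transposed_leibniz:
    "length xs = n \<Longrightarrow>
      z \<cdot> br xs = scale (1 / of_nat n) (\<Sum>i<n. br (xs[i := z \<cdot> (xs ! i)]))"

end

theory Submission
  imports Defs
begin

text \<open>
  The Leibniz rule in every slot turns the transposed Leibniz rule into
  \<open>\<Sum>i. x\<^sub>i \<cdot> [x\<^sub>1, \<dots>, z, \<dots>, x\<^sub>n] = 0\<close>, with \<open>z\<close> in slot \<open>i\<close>. Exchanging the roles of \<open>z\<close> and
  \<open>x\<^sub>j\<close> in this identity and using that the bracket is alternating gives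
  \<open>z \<cdot> [x\<^sub>1, \<dots>, x\<^sub>n] = - x\<^sub>j \<cdot> [x\<^sub>1, \<dots>, z, \<dots>, x\<^sub>n]\<close> for each \<open>j\<close>, now with \<open>z\<close> in slot \<open>j\<close>.
  Summing over \<open>j\<close> yields \<open>n (z \<cdot> [x\<^sub>1, \<dots>, x\<^sub>n]) = 0\<close>, and the Leibniz rule does the rest.
\<close>

context comm_assoc_algebra
begin

lemma mult_zero_right: "x \<cdot> 0 = 0"
  by (rule module_hom.zero[OF module_hom_linearI[OF mult_linear_right]])

lemma mult_minus_right: "x \<cdot> (- y) = - (x \<cdot> y)"
  by (rule module_hom.neg[OF module_hom_linearI[OF mult_linear_right]])

end

context n_lie_algebra
begin

text \<open>Polarization: the bracket vanishes with \<open>a + b\<close> in both slots, and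
  additivity leaves only the two mixed terms.\<close>

lemma br_swap:
  assumes "length xs = n" "i < n" "j < n" "i \<noteq> j"
  shows "br (xs[i := a, j := b]) = - br (xs[i := b, j := a])"
proof -
  have add_j: "br (ys[j := u + v]) = br (ys[j := u]) + br (ys[j := v])"
    if "length ys = n" for ys u v
    using module_hom.add[OF module_hom_linearI[OF br_multilinear[OF that \<open>j < n\<close>]]] .
  have add_i: "br (xs[i := u + v, j := w]) = br (xs[i := u, j := w]) + br (xs[i := v, j := w])"
    for u v w
    using module_hom.add[OF module_hom_linearI[OF br_multilinear[of "xs[j := w]" i]], of u v] assms
    by (simp add: list_update_swap)
  have diag: "br (xs[i := u, j := u]) = 0" for u
    using br_alternating[of "xs[i := u, j := u]" i j] assms by simp
  have "0 = br (xs[i := a + b, j := a + b])"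
    by (rule diag[symmetric])
  also have "\<dots> = br (xs[i := a, j := b]) + br (xs[i := b, j := a])"
    using assms by (simp add: add_i add_j diag[of a] diag[of b])
  finally show ?thesis
    by (metis eq_neg_iff_add_eq_0)
qed

text \<open>\<open>leibniz\<close> and the vanishing condition of the theorem address only the head
  slot; a swap carries them to slot \<open>i\<close> at the cost of a sign. Since \<open>ts\<close>
  is independent of \<open>w\<close>, brackets with different entries in slot \<open>i\<close> can
  be compared.\<close>

lemma br_slot_to_head:
  assumes "length xs = n" "i < n"
  obtains ts where "length ts = n - 1" "\<And>w. br (xs[i := w]) = br (w # ts)"
    | ts where "length ts = n - 1" "\<And>w. br (xs[i := w]) = - br (w # ts)"
proof -
  obtain h t where xs: "xs = h # t"
    using assms by (cases xs) auto
  show thesis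
  proof (cases i)
    case 0
    then show ?thesis
      using that(1)[of t] assms xs by auto
  next
    case (Suc m)
    have "br (xs[i := w]) = - br (w # t[m := h])" for w
      using br_swap[of xs 0 i h w] assms by (simp add: xs Suc)
    then show ?thesis
      using that(2)[of "t[m := h]"] assms xs by auto
  qed
qed

end

context poisson_n_lie_algebra
begin

lemma leibniz_slot:
  assumes "length xs = n" "i < n"
  shows "br (xs[i := z \<cdot> xs ! i]) = z \<cdot> br xs + xs ! i \<cdot> br (xs[i := z])"
proof -
  \<comment> \<open>With \<open>br xs\<close> written as an update, all three brackets have the form
    that \<open>br_slot_to_head\<close> rewrites; \<open>list_update_id\<close> would undo this. In
    the second case the common sign cancels.\<close>
  have "br (xs[i := z \<cdot> xs ! i]) = z \<cdot> br (xs[i := xs ! i]) + xs ! i \<cdot> br (xs[i := z])"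
    using assms
  proof (cases rule: br_slot_to_head)
    case (1 ts)
    then show ?thesis
      by (simp add: leibniz mult_commute del: list_update_id)
  next
    case (2 ts)
    then show ?thesis
      by (simp add: leibniz mult_commute mult_minus_right del: list_update_id)
  qed
  then show ?thesis
    by simp
qed

text \<open>After clearing \<open>1 / of_nat n\<close>, expanding each summand by
  \<open>leibniz_slot\<close> yields \<open>n\<close> copies of \<open>z \<cdot> br xs\<close>,
  which cancel the left-hand side.\<close>

lemma transposed_exchange_sum:
  assumes "transposed_poisson_n_lie_algebra scale mult n br"
    and "of_nat n \<noteq> (0 :: 'k)" and "length xs = n"
  shows "(\<Sum>i<n. xs ! i \<cdot> br (xs[i := z])) = 0"
proof -
  let ?S = "\<Sum>i<n. br (xs[i := z \<cdot> xs ! i])"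
  have "z \<cdot> br xs = scale (1 / of_nat n) ?S"
    using transposed_poisson_n_lie_algebra.transposed_leibniz assms by blast
  then have "scale (of_nat n) (z \<cdot> br xs) = ?S"
    using assms(2) by simp
  also have "?S = (\<Sum>i<n. z \<cdot> br xs) + (\<Sum>i<n. xs ! i \<cdot> br (xs[i := z]))"
    using assms(3) by (simp add: leibniz_slot sum.distrib)
  also have "(\<Sum>i<n. z \<cdot> br xs) = scale (of_nat n) (z \<cdot> br xs)"
    using sum_constant_scale[of "z \<cdot> br xs" "{..<n}"] by simp
  finally show ?thesis
    by simp
qed

lemma transposed_mult_br:
  assumes transposed: "transposed_poisson_n_lie_algebra scale mult n br"
    and n: "of_nat n \<noteq> (0 :: 'k)" and xs: "length xs = n"
  shows "z \<cdot> br xs = 0"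
proof -
  let ?G = "\<lambda>i. xs ! i \<cdot> br (xs[i := z])"
  have G_sum: "(\<Sum>i<n. ?G i) = 0"
    using transposed n xs by (rule transposed_exchange_sum)
  have G: "?G j = - (z \<cdot> br xs)" if j: "j < n" for j
  proof -
    let ?ys = "xs[j := z]"
    \<comment> \<open>For \<open>i \<noteq> j\<close> the updated list is \<open>xs[i := z]\<close>
      with the entries in slots \<open>i\<close> and \<open>j\<close> swapped; for
      \<open>i = j\<close> the update restores \<open>xs\<close>.\<close>
    have other: "?ys ! i \<cdot> br (?ys[i := xs ! j]) = - ?G i" if "i \<in> {..<n} - {j}" for i
    proof -
      have "br (?ys[i := xs ! j]) = - br (xs[i := z])"
        using br_swap[of xs j i z "xs ! j"] that j xs by auto
      then show ?thesis
        using that by (simp add: mult_minus_right)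
    qed
    have "0 = (\<Sum>i<n. ?ys ! i \<cdot> br (?ys[i := xs ! j]))"
      using transposed_exchange_sum[OF transposed n, of ?ys "xs ! j"] xs by simp
    also have "\<dots> = z \<cdot> br xs + (\<Sum>i\<in>{..<n} - {j}. ?ys ! i \<cdot> br (?ys[i := xs ! j]))"
      using j xs by (subst sum.remove[of _ j]) auto
    also have "\<dots> = z \<cdot> br xs - (\<Sum>i\<in>{..<n} - {j}. ?G i)"
      using other by (simp add: sum_negf)
    also have "(\<Sum>i\<in>{..<n} - {j}. ?G i) = - ?G j"
      using G_sum j by (subst (asm) sum.remove[of _ j]) (auto simp: add_eq_0_iff)
    finally show ?thesis
      by (simp add: add_eq_0_iff)
  qed
  have "scale (of_nat n) (- (z \<cdot> br xs)) = (\<Sum>j<n. - (z \<cdot> br xs))"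
    using sum_constant_scale[of "- (z \<cdot> br xs)" "{..<n}"] by simp
  also have "\<dots> = 0"
    using G_sum G by simp
  finally show ?thesis
    using n by simp
qed

end

theorem proposition34:
  fixes scale :: "complex \<Rightarrow> 'a::ab_group_add \<Rightarrow> 'a"
    and mult :: "'a \<Rightarrow> 'a \<Rightarrow> 'a"  (infixl \<open>\<cdot>\<close> 70)
    and n :: nat
    and br :: "'a list \<Rightarrow> 'a"
  assumes "n \<ge> 2"
    and "comm_assoc_algebra scale mult"
    and "n_lie_algebra scale n br"
  shows "poisson_n_lie_algebra scale mult n br \<and> transposed_poisson_n_lie_algebra scale mult n br
    \<longleftrightarrow> (\<forall>x y ys. length ys = n - 1 \<longrightarrow> x \<cdot> br (y # ys) = 0 \<and> br ((x \<cdot> y) # ys) = 0)"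
proof -
  interpret A: comm_assoc_algebra scale mult by fact
  interpret L: n_lie_algebra scale n br by fact
  show ?thesis
  proof
    assume both: "poisson_n_lie_algebra scale mult n br \<and>
      transposed_poisson_n_lie_algebra scale mult n br"
    interpret P: poisson_n_lie_algebra scale mult n br
      using both by blast
    \<comment> \<open>From \<open>n \<ge> 2\<close>, the list \<open>y # ys\<close> has length
      exactly \<open>n\<close> despite truncated subtraction, and \<open>n\<close> is nonzero in the
      complex numbers.\<close>
    have zero: "x \<cdot> br (y # ys) = 0" if "length ys = n - 1" for x y ys
      using P.transposed_mult_br[of "y # ys" x] both that \<open>n \<ge> 2\<close> by simp
    then show "\<forall>x y ys. length ys = n - 1 \<longrightarrow> x \<cdot> br (y # ys) = 0 \<and> br ((x \<cdot> y) # ys) = 0"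
      by (simp add: P.leibniz A.mult_commute[of "br _"])
  next
    assume zero: "\<forall>x y ys. length ys = n - 1 \<longrightarrow>
      x \<cdot> br (y # ys) = 0 \<and> br ((x \<cdot> y) # ys) = 0"
    have "poisson_n_lie_algebra scale mult n br"
      by unfold_locales (simp add: zero A.mult_commute[of "br _"])
    moreover have "transposed_poisson_n_lie_algebra scale mult n br"
    proof unfold_locales
      fix xs :: "'a list" and z
      assume xs: "length xs = n"
      \<comment> \<open>Moved to the head, the product is killed by the hypothesis, whatever the
        sign.\<close>
      have "br (xs[i := z \<cdot> xs ! i]) = 0" if "i < n" for i
        using xs that by (cases rule: L.br_slot_to_head) (simp_all add: zero)
      moreover have "z \<cdot> br xs = 0"
        using zero xs \<open>n \<ge> 2\<close> by (cases xs) auto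
      ultimately show "z \<cdot> br xs = scale (1 / of_nat n) (\<Sum>i<n. br (xs[i := z \<cdot> xs ! i]))"
        by simp
    qed
    ultimately show "poisson_n_lie_algebra scale mult n br \<and>
      transposed_poisson_n_lie_algebra scale mult n br" ..
  qed
qed

end
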